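(* Let $\mathcal{I}$ be a proper ideal on a set $X$. Then $\mathcal{I}$ is a maximal ideal if and only if $(\mathcal{I}:\mathcal{J})=\mathcal{I}$ for each $\mathcal{J}\subseteq 2^X$ with the property $\mathcal{J}\nsubseteq\mathcal{I}$.
   Context: An ideal on a set $X$ is a non-empty family $\mathcal{I}\subseteq 2^X$ ($2^X$ is the power set of $X$) such that (i) $A\in\mathcal{I}$ and $B\subseteq A$ imply $B\in\mathcal{I}$, and (ii) $A,B\in\mathcal{I}$ imply $A\cup B\in\mathcal{I}$. An ideal $\mathcal{I}$ is proper if $\mathcal{I}\neq 2^X$. A proper ideal $\mathcal{I}$ on $X$ is a maximal ideal if for every ideal $\mathcal{J}$ on $X$ with $\mathcal{I}\subseteq\mathcal{J}$, one has $\mathcal{I}=\mathcal{J}$ or $\mathcal{J}=2^X$. For an ideal $\mathcal{I}$ on $X$ and an arbitrary family $\mathcal{J}\subseteq 2^X$, the ideal quotient is $(\mathcal{I}:\mathcal{J})=\{A\subseteq X\mid (\forall J\in\mathcal{J})(A\cap J\in\mathcal{I})\}$. *)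

theory Defs
  imports Main
begin

definition ideal_on :: "'a set \<Rightarrow> 'a set set \<Rightarrow> bool" where
  "ideal_on X I \<longleftrightarrow>
     I \<subseteq> Pow X \<and> I \<noteq> {} \<and>
     (\<forall>A B. A \<in> I \<longrightarrow> B \<subseteq> A \<longrightarrow> B \<in> I) \<and>
     (\<forall>A B. A \<in> I \<longrightarrow> B \<in> I \<longrightarrow> A \<union> B \<in> I)"

definition proper_ideal_on :: "'a set \<Rightarrow> 'a set set \<Rightarrow> bool" where
  "proper_ideal_on X I \<longleftrightarrow> ideal_on X I \<and> I \<noteq> Pow X"

definition maximal_ideal_on :: "'a set \<Rightarrow> 'a set set \<Rightarrow> bool" where
  "maximal_ideal_on X I \<longleftrightarrow>
     proper_ideal_on X I \<and>
     (\<forall>J. ideal_on X J \<longrightarrow> I \<subseteq> J \<longrightarrow> I = J \<or> J = Pow X)"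

definition ideal_quotient :: "'a set \<Rightarrow> 'a set set \<Rightarrow> 'a set set \<Rightarrow> 'a set set" where
  "ideal_quotient X I F = {A. A \<subseteq> X \<and> (\<forall>J\<in>F. A \<inter> J \<in> I)}"

end

theory Submission
  imports Defs
begin

text \<open>
  The quotient \<open>(I : J)\<close> is always an ideal containing \<open>I\<close>, and it is the whole power set exactly
  when every member of \<open>J\<close> (a subset of \<open>X\<close>) already lies in \<open>I\<close>. So maximality leaves
  \<open>(I : J) = I\<close> as the only possibility once some member of \<open>J\<close> is outside \<open>I\<close>.

  Conversely, testing with singletons \<open>J = {B}\<close> is enough: the complement of \<open>B\<close> is disjoint
  from \<open>B\<close> and hence lies in \<open>(I : {B})\<close>. If this quotient equals \<open>I\<close> for every \<open>B\<close> outside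
  \<open>I\<close>, then \<open>I\<close> contains the complement of every subset of \<open>X\<close> that it omits, so an ideal
  strictly above \<open>I\<close> contains some set together with its complement, and therefore \<open>X\<close>.
\<close>

lemma ideal_on_empty: "ideal_on X I \<Longrightarrow> {} \<in> I"
  unfolding ideal_on_def by blast

lemma ideal_on_eq_Pow_iff:
  assumes "ideal_on X I"
  shows "I = Pow X \<longleftrightarrow> X \<in> I"
proof
  assume "X \<in> I"
  then have "Pow X \<subseteq> I"
    using assms by (auto simp: ideal_on_def)
  then show "I = Pow X"
    using assms by (simp add: ideal_on_def subset_antisym)
qed simp

lemma subset_ideal_quotient:
  assumes "ideal_on X I"
  shows "I \<subseteq> ideal_quotient X I J"
proof
  fix A assume "A \<in> I"
  moreover have "A \<inter> S \<in> I" for S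
    using assms \<open>A \<in> I\<close> Int_lower1[of A S] unfolding ideal_on_def by metis
  ultimately show "A \<in> ideal_quotient X I J"
    using assms by (auto simp: ideal_on_def ideal_quotient_def)
qed

text \<open>
  Closure under unions holds because intersecting with a fixed member of \<open>J\<close> distributes over
  the union, and under subsets because it is monotone.
\<close>

lemma ideal_on_ideal_quotient:
  assumes "ideal_on X I"
  shows "ideal_on X (ideal_quotient X I J)"
proof -
  let ?Q = "ideal_quotient X I J"
  have sub: "B \<in> I" if "A \<in> I" "B \<subseteq> A" for A B
    using assms that unfolding ideal_on_def by metis
  have un: "A \<union> B \<in> I" if "A \<in> I" "B \<in> I" for A B
    using assms that by (simp add: ideal_on_def)
  have "?Q \<subseteq> Pow X"
    unfolding ideal_quotient_def by blast
  moreover have "?Q \<noteq> {}"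
    using subset_ideal_quotient[OF assms] ideal_on_empty[OF assms] by blast
  moreover have "B \<in> ?Q" if "A \<in> ?Q" "B \<subseteq> A" for A B
  proof -
    have "B \<inter> S \<in> I" if "S \<in> J" for S
    proof (rule sub)
      show "A \<inter> S \<in> I"
        using \<open>A \<in> ?Q\<close> that by (simp add: ideal_quotient_def)
      show "B \<inter> S \<subseteq> A \<inter> S"
        using \<open>B \<subseteq> A\<close> by blast
    qed
    then show ?thesis
      using that by (auto simp: ideal_quotient_def)
  qed
  moreover have "A \<union> B \<in> ?Q" if "A \<in> ?Q" "B \<in> ?Q" for A B
    using that un by (simp add: ideal_quotient_def Int_Un_distrib2)
  ultimately show ?thesis
    by (simp add: ideal_on_def)
qed

text \<open>
  An ideal is the whole power set as soon as it contains \<open>X\<close>, and the test for \<open>X\<close> to lie in the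
  quotient reads \<open>X \<inter> S = S \<in> I\<close> for each \<open>S\<close> in \<open>J\<close>.
\<close>

lemma ideal_quotient_eq_Pow_iff:
  assumes "ideal_on X I" and "J \<subseteq> Pow X"
  shows "ideal_quotient X I J = Pow X \<longleftrightarrow> J \<subseteq> I"
proof -
  have "X \<inter> S = S" if "S \<in> J" for S
    using assms(2) that by blast
  then have "X \<in> ideal_quotient X I J \<longleftrightarrow> J \<subseteq> I"
    unfolding ideal_quotient_def by auto
  then show ?thesis
    using ideal_on_eq_Pow_iff[OF ideal_on_ideal_quotient[OF assms(1)]] by simp
qed

lemma Compl_in_ideal_quotient_singleton:
  assumes "ideal_on X I"
  shows "X - B \<in> ideal_quotient X I {B}"
proof -
  have "(X - B) \<inter> B = {}"
    by blast
  then show ?thesis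
    using ideal_on_empty[OF assms] by (auto simp: ideal_quotient_def)
qed

theorem theorem4p9:
  fixes X :: "'a set" and I :: "'a set set"
  assumes "proper_ideal_on X I"
  shows "maximal_ideal_on X I \<longleftrightarrow>
    (\<forall>J. J \<subseteq> Pow X \<longrightarrow> \<not> J \<subseteq> I \<longrightarrow> ideal_quotient X I J = I)"
proof
  have I: "ideal_on X I"
    using assms unfolding proper_ideal_on_def by blast
  {
    assume max: "maximal_ideal_on X I"
    have "ideal_quotient X I J = I" if J: "J \<subseteq> Pow X" and "\<not> J \<subseteq> I" for J
    proof -
      have "I = ideal_quotient X I J \<or> ideal_quotient X I J = Pow X"
        using max ideal_on_ideal_quotient[OF I] subset_ideal_quotient[OF I]
        unfolding maximal_ideal_on_def by simp
      then show ?thesis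
        using ideal_quotient_eq_Pow_iff[OF I J] \<open>\<not> J \<subseteq> I\<close> by simp
    qed
    then show "\<forall>J. J \<subseteq> Pow X \<longrightarrow> \<not> J \<subseteq> I \<longrightarrow> ideal_quotient X I J = I"
      by simp
  next
    assume quot: "\<forall>J. J \<subseteq> Pow X \<longrightarrow> \<not> J \<subseteq> I \<longrightarrow> ideal_quotient X I J = I"
    have "K = Pow X" if K: "ideal_on X K" and "I \<subseteq> K" "I \<noteq> K" for K
    proof -
      obtain B where B: "B \<in> K" "B \<notin> I"
        using \<open>I \<subseteq> K\<close> \<open>I \<noteq> K\<close> by blast
      then have "B \<subseteq> X"
        using K by (auto simp: ideal_on_def)
      then have "ideal_quotient X I {B} = I"
        using quot B by simp
      then have "X - B \<in> K"
        using Compl_in_ideal_quotient_singleton[OF I] \<open>I \<subseteq> K\<close> by blast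
      then have "B \<union> (X - B) \<in> K"
        using K B(1) unfolding ideal_on_def by metis
      then have "X \<in> K"
        using \<open>B \<subseteq> X\<close> by (simp add: Un_absorb1)
      then show ?thesis
        using ideal_on_eq_Pow_iff[OF K] by blast
    qed
    then show "maximal_ideal_on X I"
      using assms unfolding maximal_ideal_on_def by blast
  }
qed

end
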